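(* Let $f:[a,b]\to\mathbb{R}$ be a continuous nondecreasing function and let $(\Delta_n)_{n\geq 1}$ be a sequence of partitions of $[a,b]$ such that $\|\Delta_n\|\to 0$. Then, for any real $p\in[1,\infty)$ and any integer $m\geq 1$, the sequence $\left(\mathbf{SI}_{m}^{0}(\Delta_n,f,p)\right)_{n\geq 1}$ converges uniformly to $f$ on $[a,b]$; that is, $$\lim_{n\to\infty}\ \max_{x\in[a,b]}\left|\mathbf{SI}_{m}^{0}(\Delta_n,f,p)(x)-f(x)\right|=0.$$
   Context: Let $[a,b]$ be a compact interval with $a<b$. A partition $\Delta$ of $[a,b]$ is a finite vector of knots $\Delta=(\alpha_1,\dots,\alpha_k)$ with $a=\alpha_1<\alpha_2<\dots<\alpha_k=b$; its norm is $\|\Delta\|=\max\{\alpha_{i+1}-\alpha_i : 1\le i\le k-1\}$. In a sequence $(\Delta_n)_{n\ge1}$ of partitions, $\Delta_n$ may have an arbitrary number $k_n$ of knots, and the partitions need not be nested. For an integer $m\ge1$, a function $g:[a,b]\to\mathbb{R}$ is $\Delta$-piecewise polynomial of order $m$ if its restriction to each $[\alpha_i,\alpha_{i+1}]$, $1\le i\le k-1$, is a polynomial function of degree at most $m$. $\mathbf{SI}_m^0(\Delta)$ denotes the set of all nondecreasing functions $g:[a,b]\to\mathbb{R}$ that are continuous and $\Delta$-piecewise polynomial of order $m$. For $p\in[1,\infty)$, $\|g\|_p=\left(\int_a^b|g(x)|^p\,dx\right)^{1/p}$. For continuous $f:[a,b]\to\mathbb{R}$, $\mathbf{SI}_m^0(\Delta,f,p)$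 denotes the best $L^p$ approximation of $f$ in $\mathbf{SI}_m^0(\Delta)$, i.e. the unique element of $\mathbf{SI}_m^0(\Delta)$ such that $\|f-\mathbf{SI}_m^0(\Delta,f,p)\|_p=\min_{g\in\mathbf{SI}_m^0(\Delta)}\|f-g\|_p$ (existence and uniqueness hold for every $p\in[1,\infty)$ and every continuous $f$). *)

theory Defs
  imports "HOL-Analysis.Analysis" "HOL-Computational_Algebra.Polynomial"
begin

definition is_partition :: "real \<Rightarrow> real \<Rightarrow> real list \<Rightarrow> bool" where
  "is_partition a b D \<longleftrightarrow> D \<noteq> [] \<and> hd D = a \<and> last D = b \<and> sorted_wrt (<) D"

(* The set below is nonempty whenever D is a partition of [a,b] with a < b. *)
definition partition_norm :: "real list \<Rightarrow> real" where
  "partition_norm D = Max {D ! Suc i - D ! i | i. Suc i < length D}"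

definition piecewise_polynomial :: "nat \<Rightarrow> real list \<Rightarrow> (real \<Rightarrow> real) \<Rightarrow> bool" where
  "piecewise_polynomial m D g \<longleftrightarrow>
     (\<forall>i. Suc i < length D \<longrightarrow>
        (\<exists>q :: real poly. degree q \<le> m \<and> (\<forall>x \<in> {D ! i .. D ! Suc i}. g x = poly q x)))"

(* Functions on [a,b] are represented by total functions whose values outside [a,b]
   are irrelevant: every condition below depends only on the restriction to [a,b]. *)
definition SI0 :: "real \<Rightarrow> real \<Rightarrow> nat \<Rightarrow> real list \<Rightarrow> (real \<Rightarrow> real) set" where
  "SI0 a b m D =
     {g. mono_on {a..b} g \<and> continuous_on {a..b} g \<and> piecewise_polynomial m D g}"

definition Lp_norm :: "real \<Rightarrow> real \<Rightarrow> real \<Rightarrow> (real \<Rightarrow> real) \<Rightarrow> real" where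
  "Lp_norm a b p g = (integral {a..b} (\<lambda>x. \<bar>g x\<bar> powr p)) powr (1 / p)"

(* g is the best L^p approximation of f in SI0 a b m D.  It is determined only on [a,b],
   hence a predicate and not a function of f. *)
definition is_best_SI0_approx ::
  "real \<Rightarrow> real \<Rightarrow> nat \<Rightarrow> real list \<Rightarrow> (real \<Rightarrow> real) \<Rightarrow> real \<Rightarrow> (real \<Rightarrow> real) \<Rightarrow> bool" where
  "is_best_SI0_approx a b m D f p g \<longleftrightarrow>
     g \<in> SI0 a b m D \<and>
     (\<forall>h \<in> SI0 a b m D. Lp_norm a b p (\<lambda>x. f x - g x) \<le> Lp_norm a b p (\<lambda>x. f x - h x))"

end

theory Submission
  imports Defs
begin

text \<open>The piecewise linear interpolants of \<open>f\<close> are admissible and converge uniformly, so the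
  errors tend to \<open>0\<close> in \<open>L\<^sup>p\<close>; for monotone approximants of a continuous \<open>f\<close> this forces uniform
  convergence away from the endpoints. What has to be excluded is overshooting at \<open>b\<close> (reflection
  \<open>x \<mapsto> - x\<close> then handles \<open>a\<close>). By optimality, \<open>s\<close> is constant after the first knot \<open>v\<close> where
  \<open>s v \<ge> f b\<close>. If \<open>u\<close> is the preceding knot, then \<open>f - s u\<close> is tiny on \<open>[u, b]\<close>. If \<open>s v\<close> were much
  larger than \<open>f b\<close>, then, \<open>s\<close> being on \<open>[u, v]\<close> a nondecreasing polynomial of degree at most \<open>m\<close>,
  it would be much larger than \<open>f b\<close> on a proportion \<open>1 / (m + 1)\<close> of \<open>[u, v]\<close>, and replacing \<open>s\<close>
  by the constant \<open>s u\<close> after \<open>u\<close> would decrease the error.\<close>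

section \<open>Extrapolation and growth of nondecreasing polynomials\<close>

text \<open>The forward difference of order \<open>Suc m\<close> of \<open>q\<close> vanishes, so
  the next value is a signed binomial combination of the \<open>m + 1\<close> preceding ones, with
  absolute coefficients adding up to \<open>2 ^ Suc m - 1\<close>.\<close>

lemma poly_extrapolation_bound:
  fixes q :: "real poly"
  assumes "degree q \<le> m" "\<And>i. i \<le> m \<Longrightarrow> \<bar>poly q (u + real i * h)\<bar> \<le> M"
  shows "\<bar>poly q (u + real (Suc m) * h)\<bar> \<le> (2 ^ Suc m - 1) * M"
  using assms
proof (induction m arbitrary: q M)
  case 0
  then obtain c where "q = [:c:]" by (auto elim: degree_eq_zeroE)
  with 0(2)[of 0] show ?case by simp
next
  case (Suc m)
  \<comment> \<open>passing to the forward difference lowers the degree and doubles the bound\<close>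
  define d where "d = pcompose q [:h, 1:] - q"
  have poly_d: "poly d x = poly q (x + h) - poly q x" for x
    by (simp add: d_def poly_pcompose algebra_simps)
  have "coeff d i = 0" if "i > m" for i
  proof (cases "i = degree q")
    case True
    then have "coeff (pcompose q [:h, 1:]) i = lead_coeff (pcompose q [:h, 1:])"
      by (simp add: degree_pcompose)
    also have "\<dots> = lead_coeff q"
      by (subst lead_coeff_comp) auto
    finally show ?thesis using True by (simp add: d_def)
  next
    case False
    with that Suc.prems(1) have "degree q < i" by simp
    then show ?thesis
      by (simp add: d_def coeff_eq_0 degree_pcompose)
  qed
  then have "degree d \<le> m" by (intro degree_le) auto
  moreover have "\<bar>poly d (u + real i * h)\<bar> \<le> 2 * M" if "i \<le> m" for i
  proof -
    have "u + real i * h + h = u + real (Suc i) * h" by (simp add: algebra_simps)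
    then show ?thesis
      using Suc.prems(2)[of i] Suc.prems(2)[of "Suc i"] that by (simp only: poly_d) linarith
  qed
  ultimately have "\<bar>poly d (u + real (Suc m) * h)\<bar> \<le> (2 ^ Suc m - 1) * (2 * M)"
    by (rule Suc.IH)
  moreover have "u + real (Suc m) * h + h = u + real (Suc (Suc m)) * h"
    by (simp add: algebra_simps)
  ultimately have "\<bar>poly q (u + real (Suc (Suc m)) * h)\<bar> \<le> (2 ^ Suc m - 1) * (2 * M) + M"
    using Suc.prems(2)[of "Suc m"] by (simp only: poly_d) linarith
  then show ?case by (simp add: algebra_simps)
qed

text \<open>A nondecreasing polynomial cannot save almost all of its growth for the last
  \<open>1 / Suc m\<close> of the interval. After subtraction of \<open>poly q u\<close>, its values
  at the first \<open>m + 1\<close> equispaced points lie between 0 and the last of them, and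
  \<open>v\<close> is the next point, where extrapolation applies.\<close>

lemma mono_poly_lower_bound:
  fixes q :: "real poly"
  assumes "degree q \<le> m" "u < v" "mono_on {u..v} (poly q)"
  shows "(poly q v - poly q u) / 2 ^ Suc m \<le> poly q (v - (v - u) / real (Suc m)) - poly q u"
proof -
  define h where "h = (v - u) / real (Suc m)"
  define r where "r = q - [:poly q u:]"
  define w where "w = v - h"
  have h: "h > 0" using assms(2) by (simp add: h_def)
  have Sh: "u + real (Suc m) * h = v" by (simp add: h_def)
  then have w: "w = u + real m * h" by (simp add: w_def algebra_simps)
  have "w \<ge> u" "w \<le> v" using h by (simp_all add: w) (simp add: w_def flip: w)
  have "degree r \<le> m" using assms(1) by (simp add: r_def degree_diff_le)
  moreover have "\<bar>poly r (u + real i * h)\<bar> \<le> poly r w" if "i \<le> m" for i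
  proof -
    have 1: "real i * h \<le> real m * h" using that h by (simp add: mult_right_mono)
    have 2: "0 \<le> real i * h" using h by simp
    have 3: "u + real i * h \<in> {u..v}" "u + real i * h \<le> w" using 1 2 \<open>w \<le> v\<close> by (auto simp: w)
    have "poly q u \<le> poly q (u + real i * h)"
      using assms(2) 2 by (intro mono_onD[OF assms(3)]) (use 3 in auto)
    moreover have "poly q (u + real i * h) \<le> poly q w"
      using 3 \<open>w \<ge> u\<close> \<open>w \<le> v\<close> by (intro mono_onD[OF assms(3)]) auto
    ultimately show ?thesis by (simp add: r_def)
  qed
  ultimately have "\<bar>poly r (u + real (Suc m) * h)\<bar> \<le> (2 ^ Suc m - 1) * poly r w"
    by (rule poly_extrapolation_bound)
  then have *: "\<bar>poly r v\<bar> \<le> (2 ^ Suc m - 1) * poly r w" by (simp only: Sh)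
  moreover have "poly q u \<le> poly q w"
    using \<open>w \<ge> u\<close> \<open>w \<le> v\<close> by (intro mono_onD[OF assms(3)]) auto
  ultimately have "poly r v \<le> 2 ^ Suc m * poly r w" by (simp add: r_def algebra_simps)
  then show ?thesis by (simp add: r_def w_def h_def field_simps)
qed

section \<open>Knots and cells of a partition\<close>

lemma partition_nth_less:
  assumes "is_partition a b D" "i < j" "j < length D"
  shows "D ! i < D ! j"
  using assms by (simp add: is_partition_def sorted_wrt_iff_nth_less)

lemma partition_nth_le:
  assumes "is_partition a b D" "i \<le> j" "j < length D"
  shows "D ! i \<le> D ! j"
  using partition_nth_less[OF assms(1), of i j] assms(2,3) by (cases "i = j") auto

lemma partition_nth_0: "is_partition a b D \<Longrightarrow> D ! 0 = a"
  by (auto simp: is_partition_def hd_conv_nth)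

lemma partition_nth_last: "is_partition a b D \<Longrightarrow> D ! (length D - 1) = b"
  by (auto simp: is_partition_def last_conv_nth)

lemma partition_nth_mem:
  assumes "is_partition a b D" "i < length D"
  shows "D ! i \<in> {a..b}"
  using partition_nth_le[OF assms(1), of 0 i] partition_nth_le[OF assms(1), of i "length D - 1"]
    partition_nth_0[OF assms(1)] partition_nth_last[OF assms(1)] assms(2) by auto

lemma partition_cell:
  assumes "is_partition a b D" "a < b" "x \<in> {a..b}"
  obtains i where "Suc i < length D" "D ! i \<le> x" "x \<le> D ! Suc i"
proof -
  \<comment> \<open>The first knot not left of \<open>x\<close> is the right end of the cell, except
    for \<open>x = a\<close>: then \<open>j = 0\<close>, and the first cell is taken.\<close>
  define j where "j = (LEAST j. x \<le> D ! j)"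
  have last: "x \<le> D ! (length D - 1)" using assms(3) partition_nth_last[OF assms(1)] by simp
  have j: "x \<le> D ! j" unfolding j_def using last by (rule LeastI)
  have jl: "j \<le> length D - 1" unfolding j_def using last by (rule Least_le)
  have min: "D ! i < x" if "i < j" for i
    using that not_less_Least unfolding j_def by force
  have D: "D \<noteq> []" using assms by (simp add: is_partition_def)
  have "length D \<noteq> 1"
    using partition_nth_0[OF assms(1)] partition_nth_last[OF assms(1)] assms(2) by auto
  with D have len: "length D \<ge> 2" by (cases D; cases "tl D") auto
  show ?thesis
  proof (cases j)
    case 0
    with j partition_nth_0[OF assms(1)] assms(3) have "x = D ! 0" by auto
    moreover have "D ! 0 \<le> D ! Suc 0" using len by (intro partition_nth_le[OF assms(1)]) auto
    ultimately show ?thesis using that[of 0] len by simp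
  next
    case (Suc i)
    then show ?thesis using that[of i] j min[of i] jl len by simp
  qed
qed

section \<open>Optimality tested against truncations\<close>

lemma continuous_on_abs_powr:
  fixes g :: "real \<Rightarrow> real"
  assumes "continuous_on S g" "1 \<le> p"
  shows "continuous_on S (\<lambda>x. \<bar>g x\<bar> powr p)"
  using assms by (intro continuous_on_powr' continuous_intros) auto

text \<open>The root \<open>1 / p\<close> is strictly increasing on nonnegative numbers, so
  optimality can be tested on the integrals themselves.\<close>

lemma best_approx_integral_le:
  assumes "is_best_SI0_approx a b m D f p s" "h \<in> SI0 a b m D" "1 \<le> p"
    and "continuous_on {a..b} f"
  shows "integral {a..b} (\<lambda>x. \<bar>f x - s x\<bar> powr p) \<le> integral {a..b} (\<lambda>x. \<bar>f x - h x\<bar> powr p)"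
proof -
  have nn: "integral {a..b} (\<lambda>x. \<bar>f x - g x\<bar> powr p) \<ge> 0" if "g \<in> SI0 a b m D" for g
    using that assms(3,4)
    by (intro integral_nonneg integrable_continuous_real continuous_on_abs_powr continuous_intros)
      (auto simp: SI0_def)
  have "s \<in> SI0 a b m D" using assms(1) by (simp add: is_best_SI0_approx_def)
  from nn[OF this] nn[OF assms(2)] show ?thesis
    using assms(1-3) powr_less_mono2[of "1 / p"]
    by (force simp: is_best_SI0_approx_def Lp_norm_def not_less[symmetric])
qed

text \<open>This is the competitor for the estimates at the right end. Cutting at a knot leaves one
  polynomial on every cell: the old one to the left of the knot, a constant to the right.\<close>

lemma SI0_truncate:
  assumes "s \<in> SI0 a b m D" "is_partition a b D" "k < length D"
  shows "(\<lambda>x. s (min x (D ! k))) \<in> SI0 a b m D"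
proof -
  let ?u = "D ! k"
  have u: "?u \<in> {a..b}" using assms by (intro partition_nth_mem)
  have mono: "mono_on {a..b} s" and cont: "continuous_on {a..b} s"
    and pp: "piecewise_polynomial m D s" using assms(1) by (auto simp: SI0_def)
  have "mono_on {a..b} (\<lambda>x. s (min x ?u))"
    by (intro mono_onI mono_onD[OF mono]) (use u in auto)
  moreover have "continuous_on {a..b} (\<lambda>x. s (min x ?u))"
    by (intro continuous_on_compose2[OF cont] continuous_intros) (use u in auto)
  moreover have "piecewise_polynomial m D (\<lambda>x. s (min x ?u))"
    unfolding piecewise_polynomial_def
  proof (intro allI impI)
    fix i assume i: "Suc i < length D"
    show "\<exists>q. degree q \<le> m \<and> (\<forall>x\<in>{D ! i..D ! Suc i}. s (min x ?u) = poly q x)"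
    proof (cases "Suc i \<le> k")
      case True
      then have "D ! Suc i \<le> ?u" using assms by (intro partition_nth_le) auto
      moreover obtain q where "degree q \<le> m" "\<forall>x\<in>{D ! i..D ! Suc i}. s x = poly q x"
        using pp i by (auto simp: piecewise_polynomial_def)
      ultimately show ?thesis by (intro exI[of _ q]) (auto simp: min_absorb1)
    next
      case False
      then have "?u \<le> D ! i" using assms i by (intro partition_nth_le) auto
      then show ?thesis by (intro exI[of _ "[:s ?u:]"]) (auto simp: min_absorb2)
    qed
  qed
  ultimately show ?thesis by (simp add: SI0_def)
qed

text \<open>The truncation agrees with \<open>s\<close> up to \<open>D ! k\<close>, so optimality
  only compares the tails. They stay under one integral so that the sign of the integrand can be
  exploited.\<close>

lemma best_approx_tail_le:
  assumes "is_best_SI0_approx a b m D f p s" "is_partition a b D" "k < length D" "1 \<le> p"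
    and "continuous_on {a..b} f"
  shows "integral {D ! k..b} (\<lambda>x. \<bar>f x - s x\<bar> powr p - \<bar>f x - s (D ! k)\<bar> powr p) \<le> 0"
proof -
  let ?u = "D ! k"
  let ?g = "\<lambda>x. s (min x ?u)"
  let ?S = "\<lambda>x. \<bar>f x - s x\<bar> powr p" and ?G = "\<lambda>x. \<bar>f x - ?g x\<bar> powr p"
  have s: "s \<in> SI0 a b m D" using assms(1) by (simp add: is_best_SI0_approx_def)
  have g: "?g \<in> SI0 a b m D" using s assms by (intro SI0_truncate)
  have u: "?u \<in> {a..b}" using assms by (intro partition_nth_mem)
  have cS: "continuous_on {a..b} ?S" and cG: "continuous_on {a..b} ?G"
    using s g assms(4,5) by (auto simp: SI0_def intro!: continuous_on_abs_powr continuous_intros)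
  have int: "(\<lambda>x. ?S x - ?G x) integrable_on {a..b}"
    by (intro integrable_continuous_real continuous_intros cS cG)
  have "integral {a..?u} (\<lambda>x. ?S x - ?G x) + integral {?u..b} (\<lambda>x. ?S x - ?G x)
      = integral {a..b} (\<lambda>x. ?S x - ?G x)"
    using u int by (intro Henstock_Kurzweil_Integration.integral_combine) auto
  also have "\<dots> = integral {a..b} ?S - integral {a..b} ?G"
    by (intro integral_diff integrable_continuous_real cS cG)
  also have "\<dots> \<le> 0" using best_approx_integral_le[OF assms(1) g assms(4,5)] by simp
  also have "integral {a..?u} (\<lambda>x. ?S x - ?G x) = integral {a..?u} (\<lambda>x. 0)"
    by (intro integral_cong) (auto simp: min_absorb1)
  also have "integral {?u..b} (\<lambda>x. ?S x - ?G x)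
      = integral {?u..b} (\<lambda>x. ?S x - \<bar>f x - s ?u\<bar> powr p)"
    by (intro integral_cong) (auto simp: min_absorb2)
  finally show ?thesis by simp
qed

text \<open>From such a knot on, \<open>f x \<le> s (D ! k) \<le> s x\<close>, so truncating
  increases the error nowhere. By optimality the nonnegative difference of the errors has integral
  0, and by continuity it vanishes, in particular at \<open>b\<close>.\<close>

lemma best_approx_constant_after:
  assumes "is_best_SI0_approx a b m D f p s" "is_partition a b D" "k < length D" "1 \<le> p"
    and "continuous_on {a..b} f" "mono_on {a..b} f" "f b \<le> s (D ! k)"
  shows "s b = s (D ! k)"
proof (cases "D ! k = b")
  case False
  let ?v = "D ! k"
  let ?F = "\<lambda>x. \<bar>f x - s x\<bar> powr p - \<bar>f x - s ?v\<bar> powr p"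
  have v: "?v \<in> {a..b}" using assms by (intro partition_nth_mem)
  with False have vb: "?v < b" by auto
  have mono: "mono_on {a..b} s" and cont: "continuous_on {a..b} s"
    using assms(1) by (auto simp: SI0_def is_best_SI0_approx_def)
  have le: "s ?v \<le> s x" "f x \<le> s ?v" if "x \<in> {?v..b}" for x
  proof -
    show "s ?v \<le> s x" using that v by (intro mono_onD[OF mono]) auto
    have "f x \<le> f b" using that v by (intro mono_onD[OF assms(6)]) auto
    then show "f x \<le> s ?v" using assms(7) by simp
  qed
  have nn: "0 \<le> ?F x" if "x \<in> {?v..b}" for x
    using le[OF that] assms(4) by (auto intro!: powr_mono2)
  have sub: "{?v..b} \<subseteq> {a..b}" using v by auto
  have cF: "continuous_on {?v..b} ?F"
    using assms(4) continuous_on_subset[OF cont sub] continuous_on_subset[OF assms(5) sub]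
    by (intro continuous_intros continuous_on_abs_powr)
  have "integral {?v..b} ?F \<ge> 0"
    using nn cF by (intro integral_nonneg integrable_continuous_real)
  with best_approx_tail_le[OF assms(1-5)] have "integral {?v..b} ?F = 0" by simp
  then have "?F b = 0" using integral_eq_0_iff[OF cF vb nn] vb by auto
  then have "\<bar>f b - s b\<bar> powr p = \<bar>f b - s ?v\<bar> powr p" by simp
  moreover have "\<bar>f b - s ?v\<bar> powr p < \<bar>f b - s b\<bar> powr p" if "s ?v < s b"
    using that le[of b] vb assms(4) by (intro powr_less_mono2) auto
  ultimately show ?thesis using le[of b] vb by force
qed simp

section \<open>No overshoot at the right endpoint\<close>

lemma integral_ge_const:
  fixes F :: "real \<Rightarrow> real"
  assumes "continuous_on {u..v} F" "u \<le> v" "\<And>x. x \<in> {u..v} \<Longrightarrow> c \<le> F x"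
  shows "c * (v - u) \<le> integral {u..v} F"
proof -
  have "integral {u..v} (\<lambda>x. c) \<le> integral {u..v} F"
    using assms by (intro integral_le integrable_continuous_real) auto
  then show ?thesis using assms(2) by (simp add: mult.commute)
qed

text \<open>At \<open>c\<close> and \<open>c'\<close> the interior estimates will be available. If
  \<open>s b\<close> were larger, let \<open>v\<close> be the first knot where \<open>s\<close>
  reaches \<open>f b\<close> and \<open>u\<close> the knot before it; as \<open>v\<close> lies
  beyond \<open>c'\<close>, the mesh condition puts \<open>u\<close> beyond \<open>c\<close>.
  Truncating at \<open>u\<close> loses at most \<open>t powr p\<close> per unit length on the first
  part of \<open>[u, v]\<close> and gains at least \<open>((m + 2) * t) powr p - t powr p\<close> on
  the last \<open>1 / (m + 1)\<close> of it, so the gain wins.\<close>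

lemma best_approx_endpoint_le:
  assumes best: "is_best_SI0_approx a b m D f p s" and part: "is_partition a b D" and p: "1 \<le> p"
    and contf: "continuous_on {a..b} f" and monof: "mono_on {a..b} f"
    and t: "0 < t" "(real m + 3) * t \<le> e / 2 ^ Suc m"
    and c: "a \<le> c" "c \<le> c'" "c' \<le> b"
    and near: "f b - t \<le> f c" "f b - t \<le> s c" "s c' \<le> f b + e"
    and mesh: "\<And>i. Suc i < length D \<Longrightarrow> D ! Suc i - D ! i \<le> c' - c"
  shows "s b \<le> f b + e"
proof (rule ccontr)
  assume "\<not> ?thesis"
  then have sb: "s b > f b + e" by simp
  have "0 < (real m + 3) * t" using t(1) by (intro mult_pos_pos) auto
  with t(2) have e: "e > 0" by (smt (verit) zero_less_divide_iff zero_less_power)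
  have mono: "mono_on {a..b} s" and cont: "continuous_on {a..b} s"
    and pp: "piecewise_polynomial m D s"
    using best by (auto simp: SI0_def is_best_SI0_approx_def)
  define k where "k = (LEAST k. f b \<le> s (D ! k))"
  have last: "f b \<le> s (D ! (length D - 1))" using sb e partition_nth_last[OF part] by simp
  have k: "f b \<le> s (D ! k)" unfolding k_def using last by (rule LeastI)
  have "k \<le> length D - 1" unfolding k_def using last by (rule Least_le)
  moreover have "D \<noteq> []" using part by (simp add: is_partition_def)
  ultimately have kl: "k < length D" by (cases D) auto
  have min: "s (D ! i) < f b" if "i < k" for i
    using that not_less_Least unfolding k_def by force
  have const: "s b = s (D ! k)"
    by (rule best_approx_constant_after[OF best part kl p contf monof k])
  have v: "D ! k \<in> {a..b}" by (rule partition_nth_mem[OF part kl])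
  \<comment> \<open>The value \<open>s (D ! k) = s b\<close> exceeds \<open>f b + e\<close>, a
    height not passed up to \<open>c'\<close>. In particular \<open>D ! k\<close> is not the first
    knot and has a predecessor.\<close>
  have vc: "c' < D ! k"
  proof (rule ccontr)
    assume "\<not> c' < D ! k"
    then have "s (D ! k) \<le> s c'" using v c by (intro mono_onD[OF mono]) auto
    with const sb near show False by simp
  qed
  have "k \<noteq> 0" using vc c partition_nth_0[OF part] by (cases k) auto
  then obtain i where ki: "k = Suc i" by (cases k) auto
  define u where "u = D ! i"
  define v where "v = D ! k"
  define w where "w = v - (v - u) / real (Suc m)"
  have uab: "u \<in> {a..b}" using partition_nth_mem[OF part, of i] kl ki by (simp add: u_def)
  have vab: "v \<in> {a..b}" using v by (simp add: v_def)
  have uv: "u < v" using part kl ki by (auto simp: u_def v_def intro: partition_nth_less)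
  have cu: "c < u" using mesh[of i] kl vc by (simp add: u_def ki)
  have su: "s u < f b" using min[of i] ki by (simp add: u_def)
  have sv: "s v > f b + e" using const sb by (simp add: v_def)
  have uw: "u \<le> w" and wv: "w < v"
    using uv mult_left_mono[of 1 "real (Suc m)" "v - u"]
    by (auto simp: w_def field_simps)
  have wab: "w \<in> {a..b}" using uw wv uab vab by auto
  have "s c \<le> s u" using cu c uab by (intro mono_onD[OF mono]) auto
  with near have su': "f b - t \<le> s u" by simp
  have fx: "f b - t \<le> f x" "f x \<le> f b" if "x \<in> {u..b}" for x
  proof -
    have "f c \<le> f x" using that cu c uab by (intro mono_onD[OF monof]) auto
    with near show "f b - t \<le> f x" by simp
    show "f x \<le> f b" using that uab by (intro mono_onD[OF monof]) auto
  qed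
  obtain q where q: "degree q \<le> m" "\<forall>x\<in>{u..v}. s x = poly q x"
    using pp kl ki by (auto simp: piecewise_polynomial_def u_def v_def)
  have "mono_on {u..v} (poly q)"
  proof (rule mono_onI)
    fix x y assume xy: "x \<in> {u..v}" "y \<in> {u..v}" "x \<le> y"
    then have "s x \<le> s y" using uab vab by (intro mono_onD[OF mono]) auto
    with xy q(2) show "poly q x \<le> poly q y" by simp
  qed
  from mono_poly_lower_bound[OF q(1) uv this]
  have "(s v - s u) / 2 ^ Suc m \<le> s w - s u"
    using q(2) uv uw wv by (simp add: w_def)
  moreover have "e / 2 ^ Suc m \<le> (s v - s u) / 2 ^ Suc m"
    using sv su by (intro divide_right_mono) auto
  ultimately have "s w \<ge> s u + e / 2 ^ Suc m" by simp
  \<comment> \<open>Of the \<open>(m + 3) * t\<close> granted by the hypothesis one \<open>t\<close>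
    is lost, because \<open>s u\<close> may lie that far below \<open>f b\<close>.\<close>
  with t(2) su' have sw: "s w - f b \<ge> (real m + 2) * t" by (simp add: algebra_simps)
  \<comment> \<open>\<open>F\<close> is the pointwise cost of \<open>s\<close> minus that of its
    truncation at \<open>u\<close>. On \<open>[u, b]\<close> the latter is at most
    \<open>t powr p\<close>, since \<open>f\<close> and \<open>s u\<close> both lie in
    \<open>[f b - t, f b]\<close>.\<close>
  define F where "F x = \<bar>f x - s x\<bar> powr p - \<bar>f x - s u\<bar> powr p" for x
  have F: "F x \<ge> \<bar>f x - s x\<bar> powr p - t powr p" if "x \<in> {u..b}" for x
    using fx[OF that] su su' p t by (auto simp: F_def intro!: powr_mono2)
  have F1: "F x \<ge> - (t powr p)" if "x \<in> {u..w}" for x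
  proof -
    have "x \<in> {u..b}" using that wab by auto
    from F[OF this] powr_ge_zero[of "\<bar>f x - s x\<bar>" p] show ?thesis by linarith
  qed
  have F2: "F x \<ge> ((real m + 2) * t) powr p - t powr p" if "x \<in> {w..v}" for x
  proof -
    have "s w \<le> s x" using that wab vab by (intro mono_onD[OF mono]) auto
    moreover have x: "x \<in> {u..b}" using that uw vab by auto
    ultimately have "\<bar>f x - s x\<bar> powr p \<ge> ((real m + 2) * t) powr p"
      using fx[OF x] sw p t by (intro powr_mono2) auto
    with F[OF x] show ?thesis by simp
  qed
  have "1 * t \<le> (real m + 2) * t" using t by (intro mult_right_mono) auto
  with sw have tw: "t \<le> s w - f b" by linarith
  have F3: "F x \<ge> 0" if "x \<in> {v..b}" for x
  proof -
    have "s w \<le> s x" using that wab vab wv by (intro mono_onD[OF mono]) auto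
    moreover have x: "x \<in> {u..b}" using that uv by auto
    ultimately have "\<bar>f x - s x\<bar> powr p \<ge> t powr p"
      using fx[OF x] tw p t by (intro powr_mono2) auto
    with F[OF x] show ?thesis by simp
  qed
  have contF: "continuous_on {y..z} F" if "u \<le> y" "z \<le> b" for y z
  proof -
    have "{y..z} \<subseteq> {a..b}" using that uab by auto
    then have "continuous_on {y..z} f" "continuous_on {y..z} s"
      using cont contf continuous_on_subset by blast+
    then show ?thesis unfolding F_def
      using p by (intro continuous_intros continuous_on_abs_powr)
  qed
  have "integral {u..b} F \<le> 0"
    using best_approx_tail_le[OF best part _ p contf, of i] kl ki by (simp add: F_def[abs_def] u_def)
  moreover have "integral {u..w} F + integral {w..b} F = integral {u..b} F"
    using uw wab contF[of u b]
    by (intro Henstock_Kurzweil_Integration.integral_combine integrable_continuous_real) auto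
  moreover have "integral {w..v} F + integral {v..b} F = integral {w..b} F"
    using uw wv vab contF[of w b]
    by (intro Henstock_Kurzweil_Integration.integral_combine integrable_continuous_real) auto
  moreover have "- (t powr p) * (w - u) \<le> integral {u..w} F"
    using uw wab contF F1 by (intro integral_ge_const) auto
  moreover have "(((real m + 2) * t) powr p - t powr p) * (v - w) \<le> integral {w..v} F"
    using uw wv vab contF F2 by (intro integral_ge_const) auto
  moreover have "0 * (b - v) \<le> integral {v..b} F"
    using uv vab contF F3 by (intro integral_ge_const) auto
  ultimately have le: "- (t powr p) * (w - u) + (((real m + 2) * t) powr p - t powr p) * (v - w) \<le> 0"
    by simp
  \<comment> \<open>The point \<open>w\<close> splits \<open>[u, v]\<close> in the ratio
    \<open>m : 1\<close>, so the loss counts \<open>m\<close> times and the gain once.\<close>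
  have "w - u = real m * (v - w)" by (simp add: w_def field_simps)
  with le have "(v - w) * (((real m + 2) * t) powr p - (real m + 1) * t powr p) \<le> 0"
    by (simp add: algebra_simps)
  with wv have "((real m + 2) * t) powr p \<le> (real m + 1) * t powr p"
    by (simp add: mult_le_0_iff)
  \<comment> \<open>As \<open>p \<ge> 1\<close>, the factor \<open>(m + 2) powr p\<close> is at
    least \<open>m + 2\<close> and beats \<open>m + 1\<close>.\<close>
  moreover have "(real m + 2) powr 1 \<le> (real m + 2) powr p"
    using p by (intro powr_mono) auto
  then have "(real m + 2) * t powr p \<le> ((real m + 2) * t) powr p"
    using t by (simp add: powr_mult mult_right_mono)
  moreover have "0 < t powr p" using t by simp
  ultimately show False by (simp add: algebra_simps)
qed

section \<open>Piecewise linear interpolation and convergence in the interior\<close>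

text \<open>The witness is the linear interpolant at the knots. On each cell both it and
  \<open>f\<close> lie between the values of \<open>f\<close> at the two ends.\<close>

lemma exists_SI0_near:
  assumes part: "is_partition a b D" and "a < b" "1 \<le> m" and monof: "mono_on {a..b} f"
    and osc: "\<And>i. Suc i < length D \<Longrightarrow> f (D ! Suc i) - f (D ! i) \<le> t"
  shows "\<exists>h\<in>SI0 a b m D. \<forall>x\<in>{a..b}. \<bar>f x - h x\<bar> \<le> t"
proof -
  define N where "N = length D - 1"
  \<comment> \<open>A sum of clamped ramps, each rising from 0 to 1 on its cell, gives monotonicity
    and continuity termwise, without gluing.\<close>
  define \<phi> where "\<phi> i x = min 1 (max 0 ((x - D ! i) / (D ! Suc i - D ! i)))" for i x
  define h where "h x = f a + (\<Sum>i<N. (f (D ! Suc i) - f (D ! i)) * \<phi> i x)" for x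
  have step: "D ! i < D ! Suc i" if "i < N" for i
    using that by (intro partition_nth_less[OF part]) (auto simp: N_def)
  have fstep: "f (D ! i) \<le> f (D ! Suc i)" if "i < N" for i
    using that step[OF that] partition_nth_mem[OF part, of i] partition_nth_mem[OF part, of "Suc i"]
    by (intro mono_onD[OF monof]) (auto simp: N_def)
  have mono\<phi>: "\<phi> i x \<le> \<phi> i y" if "i < N" "x \<le> y" for i x y
  proof -
    have "(x - D ! i) / (D ! Suc i - D ! i) \<le> (y - D ! i) / (D ! Suc i - D ! i)"
      using that step[of i] by (intro divide_right_mono) auto
    then show ?thesis by (auto simp: \<phi>_def)
  qed
  have monoh: "h x \<le> h y" if "x \<le> y" for x y
    unfolding h_def using that fstep by (intro add_left_mono sum_mono mult_left_mono mono\<phi>) auto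
  have conth: "continuous_on {a..b} h"
    unfolding h_def \<phi>_def using step by (intro continuous_intros) force
  \<comment> \<open>On cell \<open>j\<close> the earlier ramps equal 1 and the later ones 0, so the
    sum telescopes to \<open>f (D ! j)\<close> plus one partial ramp.\<close>
  have cell: "h x = f (D ! j) + (f (D ! Suc j) - f (D ! j)) * ((x - D ! j) / (D ! Suc j - D ! j))"
    if j: "j < N" and x: "x \<in> {D ! j..D ! Suc j}" for j x
  proof -
    have lt: "\<phi> i x = 1" if "i < j" for i
    proof -
      have "D ! Suc i \<le> D ! j" using that j by (intro partition_nth_le[OF part]) (auto simp: N_def)
      with x step[of i] that j have "(x - D ! i) / (D ! Suc i - D ! i) \<ge> 1" by (simp add: field_simps)
      then show ?thesis by (simp add: \<phi>_def)
    qed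
    have gt: "\<phi> i x = 0" if "i \<in> {..<N} - {..<Suc j}" for i
    proof -
      have "D ! Suc j \<le> D ! i" using that j by (intro partition_nth_le[OF part]) (auto simp: N_def)
      with x step[of i] that have "(x - D ! i) / (D ! Suc i - D ! i) \<le> 0"
        by (simp add: divide_le_0_iff)
      then show ?thesis by (simp add: \<phi>_def)
    qed
    have eq: "\<phi> j x = (x - D ! j) / (D ! Suc j - D ! j)"
      using x step[OF j] by (simp add: \<phi>_def min_def max_def field_simps)
    have "(\<Sum>i<N. (f (D ! Suc i) - f (D ! i)) * \<phi> i x)
        = (\<Sum>i<Suc j. (f (D ! Suc i) - f (D ! i)) * \<phi> i x)"
      using j gt by (intro sum.mono_neutral_right) auto
    also have "\<dots> = (\<Sum>i<j. f (D ! Suc i) - f (D ! i)) + (f (D ! Suc j) - f (D ! j)) * \<phi> j x"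
      using lt by simp
    also have "(\<Sum>i<j. f (D ! Suc i) - f (D ! i)) = f (D ! j) - f a"
      using sum_lessThan_telescope[of "\<lambda>i. f (D ! i)" j] partition_nth_0[OF part] by simp
    finally show ?thesis by (simp add: h_def eq)
  qed
  have "piecewise_polynomial m D h"
    unfolding piecewise_polynomial_def
  proof (intro allI impI)
    fix j assume "Suc j < length D"
    then have j: "j < N" by (simp add: N_def)
    define c where "c = (f (D ! Suc j) - f (D ! j)) / (D ! Suc j - D ! j)"
    have "degree [:f (D ! j) - c * D ! j, c:] \<le> m"
      using assms(3) by (intro order.trans[OF degree_pCons_le]) simp
    moreover have "h x = poly [:f (D ! j) - c * D ! j, c:] x" if "x \<in> {D ! j..D ! Suc j}" for x
      using cell[OF j that] by (simp add: c_def diff_divide_distrib algebra_simps)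
    ultimately show "\<exists>q. degree q \<le> m \<and> (\<forall>x\<in>{D ! j..D ! Suc j}. h x = poly q x)" by blast
  qed
  then have "h \<in> SI0 a b m D" using monoh conth by (auto simp: SI0_def intro: mono_onI)
  moreover have "\<bar>f x - h x\<bar> \<le> t" if x: "x \<in> {a..b}" for x
  proof -
    obtain j where j: "Suc j < length D" "D ! j \<le> x" "x \<le> D ! Suc j"
      using partition_cell[OF part assms(2) x] .
    then have jN: "j < N" by (simp add: N_def)
    have "D ! j \<in> {a..b}" "D ! Suc j \<in> {a..b}" 
      using j partition_nth_mem[OF part, of j] partition_nth_mem[OF part, of "Suc j"] by auto
    then have "f (D ! j) \<le> f x" "f x \<le> f (D ! Suc j)"
      using x j by (auto intro!: mono_onD[OF monof])
    moreover have "h (D ! j) = f (D ! j)" "h (D ! Suc j) = f (D ! Suc j)"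
      using cell[OF jN] step[OF jN] by auto
    then have "f (D ! j) \<le> h x" "h x \<le> f (D ! Suc j)" using monoh j by metis+
    ultimately show ?thesis using osc[OF j(1)] by simp
  qed
  ultimately show ?thesis by blast
qed

text \<open>A small integral error forces every window of length \<open>l\<close> to contain a point
  where \<open>s\<close> is close to \<open>f\<close>; monotonicity of \<open>s\<close> and uniform
  continuity of \<open>f\<close> carry this to \<open>x\<close>. The upper bound needs a window to
  the right of \<open>x\<close>, the lower bound one to the left, whence the two margins.\<close>

lemma best_approx_interior_near:
  fixes f :: "real \<Rightarrow> real"
  assumes "a < b" and p: "1 \<le> p" and m: "1 \<le> m"
    and contf: "continuous_on {a..b} f" and monof: "mono_on {a..b} f"
    and "0 < e" "0 < \<eta>"
  shows "\<exists>\<delta>>0. \<forall>D s. is_partition a b D \<longrightarrow> (\<forall>i. Suc i < length D \<longrightarrow> D ! Suc i - D ! i \<le> \<delta>) \<longrightarrow>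
    is_best_SI0_approx a b m D f p s \<longrightarrow>
    (\<forall>x\<in>{a..b}. (x + \<eta> \<le> b \<longrightarrow> s x \<le> f x + e) \<and> (a \<le> x - \<eta> \<longrightarrow> f x - e \<le> s x))"
proof -
  have uc: "uniformly_continuous_on {a..b} f"
    using contf by (intro compact_uniformly_continuous) auto
  obtain \<eta>1 where \<eta>1: "\<eta>1 > 0"
    "\<And>x y. x \<in> {a..b} \<Longrightarrow> y \<in> {a..b} \<Longrightarrow> dist y x < \<eta>1 \<Longrightarrow> dist (f y) (f x) < e / 2"
    using uniformly_continuous_onE[OF uc, of "e / 2"] \<open>0 < e\<close> by (metis half_gt_zero)
  \<comment> \<open>\<open>l \<le> \<eta>\<close> keeps the windows inside \<open>[a, b]\<close>,
    and \<open>l < \<eta>1\<close> keeps the change of \<open>f\<close> on a window below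
    \<open>e / 2\<close>.\<close>
  define l where "l = min \<eta> (\<eta>1 / 2)"
  have l: "0 < l" "l \<le> \<eta>" "l < \<eta>1" using \<open>0 < \<eta>\<close> \<eta>1(1) by (auto simp: l_def)
  \<comment> \<open>An error of at least \<open>e / 2\<close> on a whole window costs
    \<open>l * (e / 2) powr p\<close>; an interpolant with error at most
    \<open>t = K powr (1 / p)\<close> costs at most half of this.\<close>
  define K where "K = l * (e / 2) powr p / (2 * (b - a))"
  have K: "K > 0" using l \<open>0 < e\<close> \<open>a < b\<close> by (simp add: K_def)
  define t where "t = K powr (1 / p)"
  have t: "t > 0" "t powr p = K" using K p by (simp_all add: t_def powr_powr)
  obtain \<delta>1 where \<delta>1: "\<delta>1 > 0"
    "\<And>x y. x \<in> {a..b} \<Longrightarrow> y \<in> {a..b} \<Longrightarrow> dist y x < \<delta>1 \<Longrightarrow> dist (f y) (f x) < t"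
    using uniformly_continuous_onE[OF uc t(1)] by metis
  show ?thesis
  proof (intro exI[of _ "\<delta>1 / 2"] conjI allI impI)
    fix D s
    assume part: "is_partition a b D"
      and mesh: "\<forall>i. Suc i < length D \<longrightarrow> D ! Suc i - D ! i \<le> \<delta>1 / 2"
      and best: "is_best_SI0_approx a b m D f p s"
    have mono: "mono_on {a..b} s" and cont: "continuous_on {a..b} s"
      using best by (auto simp: SI0_def is_best_SI0_approx_def)
    let ?F = "\<lambda>x. \<bar>f x - s x\<bar> powr p"
    have contF: "continuous_on {a..b} ?F"
      using p cont contf by (intro continuous_intros continuous_on_abs_powr)
    have "f (D ! Suc i) - f (D ! i) \<le> t" if "Suc i < length D" for i
    proof -
      have "D ! i \<in> {a..b}" "D ! Suc i \<in> {a..b}" "D ! i < D ! Suc i"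
        using that partition_nth_mem[OF part, of i] partition_nth_mem[OF part, of "Suc i"]
          partition_nth_less[OF part, of i "Suc i"] by auto
      then show ?thesis
        using \<delta>1(2)[of "D ! i" "D ! Suc i"] \<delta>1(1) mesh that by (fastforce simp: dist_real_def)
    qed
    then obtain h where h: "h \<in> SI0 a b m D" "\<forall>x\<in>{a..b}. \<bar>f x - h x\<bar> \<le> t"
      using exists_SI0_near[OF part \<open>a < b\<close> m monof] by blast
    have "integral {a..b} ?F \<le> integral {a..b} (\<lambda>x. \<bar>f x - h x\<bar> powr p)"
      by (rule best_approx_integral_le[OF best h(1) p contf])
    also have "\<dots> \<le> integral {a..b} (\<lambda>x. t powr p)"
      using h p contf
      by (intro integral_le integrable_continuous_real continuous_on_abs_powr continuous_intros)
        (auto simp: SI0_def intro!: powr_mono2)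
    also have "\<dots> < l * (e / 2) powr p"
      using \<open>a < b\<close> l \<open>0 < e\<close> by (simp add: t K_def field_simps)
    finally have small: "integral {a..b} ?F < l * (e / 2) powr p" .
    have close: "\<exists>z\<in>{y..y + l}. \<bar>f z - s z\<bar> < e / 2" if "a \<le> y" "y + l \<le> b" for y
    proof (rule ccontr)
      assume far: "\<not> ?thesis"
      have sub: "{y..y + l} \<subseteq> {a..b}" using that by auto
      have "(e / 2) powr p * (y + l - y) \<le> integral {y..y + l} ?F"
        using far \<open>0 < e\<close> p l continuous_on_subset[OF contF sub]
        by (intro integral_ge_const) (auto simp: not_less intro!: powr_mono2)
      also have "\<dots> \<le> integral {a..b} ?F"
        using sub contF continuous_on_subset[OF contF sub]
        by (intro integral_subset_le integrable_continuous_real) auto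
      finally show False using small by (simp add: mult.commute)
    qed
    show "\<forall>x\<in>{a..b}. (x + \<eta> \<le> b \<longrightarrow> s x \<le> f x + e) \<and> (a \<le> x - \<eta> \<longrightarrow> f x - e \<le> s x)"
    proof (intro ballI conjI impI)
      fix x assume x: "x \<in> {a..b}" "x + \<eta> \<le> b"
      then obtain z where z: "z \<in> {x..x + l}" "\<bar>f z - s z\<bar> < e / 2"
        using close[of x] l by auto
      have "dist (f z) (f x) < e / 2"
        using x z l by (intro \<eta>1(2)) (auto simp: dist_real_def)
      moreover have "s x \<le> s z" using x z l by (intro mono_onD[OF mono]) auto
      ultimately show "s x \<le> f x + e" using z(2) unfolding dist_real_def by linarith
    next
      fix x assume x: "x \<in> {a..b}" "a \<le> x - \<eta>"
      then obtain z where z: "z \<in> {x - l..x}" "\<bar>f z - s z\<bar> < e / 2"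
        using close[of "x - l"] l by auto
      have "dist (f z) (f x) < e / 2"
        using x z l by (intro \<eta>1(2)) (auto simp: dist_real_def)
      moreover have "s z \<le> s x" using x z l by (intro mono_onD[OF mono]) auto
      ultimately show "f x - e \<le> s x" using z(2) unfolding dist_real_def by linarith
    qed
  qed (use \<delta>1 in simp)
qed

section \<open>The uniform upper bound\<close>

text \<open>Away from \<open>b\<close> the interior estimate suffices. Near \<open>b\<close>,
  \<open>s x\<close> is at most \<open>s b\<close>, which the endpoint estimate controls, and
  \<open>f x\<close> is close to \<open>f b\<close>.\<close>

lemma best_approx_upper_bound:
  fixes f :: "real \<Rightarrow> real"
  assumes "a < b" and p: "1 \<le> p" and m: "1 \<le> m"
    and contf: "continuous_on {a..b} f" and monof: "mono_on {a..b} f" and "0 < e"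
  shows "\<exists>\<delta>>0. \<forall>D s. is_partition a b D \<longrightarrow> (\<forall>i. Suc i < length D \<longrightarrow> D ! Suc i - D ! i \<le> \<delta>) \<longrightarrow>
    is_best_SI0_approx a b m D f p s \<longrightarrow> (\<forall>x\<in>{a..b}. s x \<le> f x + e)"
proof -
  \<comment> \<open>This gives equality in the smallness condition of
    \<open>best_approx_endpoint_le\<close> for \<open>e / 2\<close>.\<close>
  define t where "t = (e / 2) / 2 ^ Suc m / (real m + 3)"
  have t: "0 < t" using \<open>0 < e\<close> by (simp add: t_def)
  have te: "(real m + 3) * t \<le> (e / 2) / 2 ^ Suc m" by (simp add: t_def)
  have "1 * t \<le> (real m + 3) * t" using t by (intro mult_right_mono) auto
  also have "\<dots> \<le> (e / 2) / 1"
    using te by (rule order.trans)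
      (use \<open>0 < e\<close> one_le_power[of "2::real" "Suc m"] in \<open>intro divide_left_mono, auto\<close>)
  finally have te': "t \<le> e / 2" by simp
  have uc: "uniformly_continuous_on {a..b} f"
    using contf by (intro compact_uniformly_continuous) auto
  obtain \<eta>1 where \<eta>1: "\<eta>1 > 0"
    "\<And>x y. x \<in> {a..b} \<Longrightarrow> y \<in> {a..b} \<Longrightarrow> dist y x < \<eta>1 \<Longrightarrow> dist (f y) (f x) < t / 2"
    using uniformly_continuous_onE[OF uc, of "t / 2"] t by (metis half_gt_zero)
  \<comment> \<open>The points \<open>b - 2 * \<eta>\<close> and \<open>b - \<eta>\<close> will
    serve as \<open>c\<close> and \<open>c'\<close>. The thirds keep the first of them at distance
    at least \<open>\<eta>\<close> from \<open>a\<close>, where the lower interior estimate holds,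
    and within \<open>\<eta>1\<close> of \<open>b\<close>.\<close>
  define \<eta> where "\<eta> = min (\<eta>1 / 3) ((b - a) / 3)"
  have \<eta>: "0 < \<eta>" "2 * \<eta> < \<eta>1" "3 * \<eta> \<le> b - a"
    using \<open>a < b\<close> \<eta>1(1) by (auto simp: \<eta>_def min_def)
  have fb: "f b - t / 2 \<le> f x" if "x \<in> {b - 2 * \<eta>..b}" for x
  proof -
    have "dist (f x) (f b) < t / 2"
      using that \<eta> by (intro \<eta>1(2)) (auto simp: dist_real_def)
    then show ?thesis unfolding dist_real_def by linarith
  qed
  obtain \<delta> where \<delta>: "\<delta> > 0" and interior: "\<And>D s x. is_partition a b D \<Longrightarrow>
      \<forall>i. Suc i < length D \<longrightarrow> D ! Suc i - D ! i \<le> \<delta> \<Longrightarrow>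
      is_best_SI0_approx a b m D f p s \<Longrightarrow> x \<in> {a..b} \<Longrightarrow>
      (x + \<eta> \<le> b \<longrightarrow> s x \<le> f x + t / 2) \<and> (a \<le> x - \<eta> \<longrightarrow> f x - t / 2 \<le> s x)"
    using best_approx_interior_near[OF \<open>a < b\<close> p m contf monof half_gt_zero[OF t] \<eta>(1)] by blast
  show ?thesis
  \<comment> \<open>\<open>\<delta>\<close> serves the interior estimate, and \<open>\<eta>\<close>
    is the distance from \<open>c\<close> to \<open>c'\<close> in the endpoint estimate.\<close>
  proof (intro exI[of _ "min \<delta> \<eta>"] conjI allI impI ballI)
    fix D s x
    assume part: "is_partition a b D"
      and mesh: "\<forall>i. Suc i < length D \<longrightarrow> D ! Suc i - D ! i \<le> min \<delta> \<eta>"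
      and best: "is_best_SI0_approx a b m D f p s"
      and x: "x \<in> {a..b}"
    have mesh': "\<forall>i. Suc i < length D \<longrightarrow> D ! Suc i - D ! i \<le> \<delta>" using mesh by simp
    note interior' = interior[OF part mesh' best]
    have mono: "mono_on {a..b} s" using best by (auto simp: SI0_def is_best_SI0_approx_def)
    have "s b \<le> f b + e / 2"
    proof (rule best_approx_endpoint_le[OF best part p contf monof t te,
        where c = "b - 2 * \<eta>" and c' = "b - \<eta>"])
      show "f b - t \<le> f (b - 2 * \<eta>)" using fb[of "b - 2 * \<eta>"] \<eta> t by simp
      show "f b - t \<le> s (b - 2 * \<eta>)" using interior'[of "b - 2 * \<eta>"] fb[of "b - 2 * \<eta>"] \<eta> by auto
      have "f (b - \<eta>) \<le> f b" using \<eta> by (intro mono_onD[OF monof]) auto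
      then show "s (b - \<eta>) \<le> f b + e / 2" using interior'[of "b - \<eta>"] \<eta> te' t by auto
    qed (use \<eta> mesh in auto)
    show "s x \<le> f x + e"
    proof (cases "x + \<eta> \<le> b")
      case True
      then show ?thesis using interior'[OF x] te' \<open>0 < e\<close> by auto
    next
      case False
      have "s x \<le> s b" using x \<open>a < b\<close> by (intro mono_onD[OF mono]) auto
      with \<open>s b \<le> f b + e / 2\<close> fb[of x] False x \<eta> te' t show ?thesis by auto
    qed
  qed (use \<delta> \<eta> in simp)
qed

section \<open>Reflection and the uniform lower bound\<close>

lemma reflect_cell:
  assumes "Suc i < length D"
  obtains j where "Suc j < length D" "map uminus (rev D) ! i = - (D ! Suc j :: real)"
    "map uminus (rev D) ! Suc i = - (D ! j)"
proof -
  \<comment> \<open>Reversal sends index \<open>i\<close> to \<open>length D - 1 - i\<close>. A cell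
    is indexed by its left knot, and reflection swaps its ends, which shifts the index by one
    more.\<close>
  define j where "j = length D - Suc (Suc i)"
  have "Suc j = length D - Suc i" using assms by (simp add: j_def)
  with assms show ?thesis by (intro that[of j]) (auto simp: rev_nth j_def)
qed

lemma is_partition_reflect:
  assumes "is_partition a b D"
  shows "is_partition (- b) (- a) (map uminus (rev D))"
  using assms
  by (auto simp: is_partition_def hd_map hd_rev last_map last_rev sorted_wrt_map sorted_wrt_rev)

text \<open>The outer sign undoes the order reversal caused by \<open>- x\<close>; hence values are
  negated along with arguments throughout.\<close>

lemma mono_on_reflect:
  fixes g :: "real \<Rightarrow> real"
  assumes "mono_on {a..b} g"
  shows "mono_on {- b..- a} (\<lambda>x. - g (- x))"
  by (intro mono_onI le_imp_neg_le mono_onD[OF assms]) auto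

lemma continuous_on_reflect:
  fixes g :: "real \<Rightarrow> real"
  assumes "continuous_on {a..b} g"
  shows "continuous_on {- b..- a} (\<lambda>x. - g (- x))"
  by (intro continuous_intros continuous_on_compose2[OF assms]) auto

lemma SI0_reflect:
  assumes "g \<in> SI0 a b m D"
  shows "(\<lambda>x. - g (- x)) \<in> SI0 (- b) (- a) m (map uminus (rev D))"
proof -
  have "piecewise_polynomial m (map uminus (rev D)) (\<lambda>x. - g (- x))"
    unfolding piecewise_polynomial_def
  proof (intro allI impI)
    fix i assume "Suc i < length (map uminus (rev D))"
    then obtain j where j: "Suc j < length D" "map uminus (rev D) ! i = - (D ! Suc j)"
      "map uminus (rev D) ! Suc i = - (D ! j)"
      using reflect_cell[of i D] by auto
    obtain q where q: "degree q \<le> m" "\<forall>x\<in>{D ! j..D ! Suc j}. g x = poly q x"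
      using assms j(1) by (auto simp: SI0_def piecewise_polynomial_def)
    show "\<exists>q. degree q \<le> m \<and>
        (\<forall>x\<in>{map uminus (rev D) ! i..map uminus (rev D) ! Suc i}. - g (- x) = poly q x)"
      using q j by (intro exI[of _ "- pcompose q [:0, -1:]"]) (auto simp: poly_pcompose degree_pcompose)
  qed
  with assms show ?thesis by (simp add: SI0_def mono_on_reflect continuous_on_reflect)
qed

lemma Lp_norm_reflect: "Lp_norm (- b) (- a) p (\<lambda>x. g (- x)) = Lp_norm a b p g"
  using Henstock_Kurzweil_Integration.integral_reflect_real[of b a "\<lambda>x. \<bar>g x\<bar> powr p"]
  by (simp add: Lp_norm_def)

lemma Lp_norm_minus_commute: "Lp_norm a b p (\<lambda>x. f x - g x) = Lp_norm a b p (\<lambda>x. g x - f x)"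
  by (simp add: Lp_norm_def abs_minus_commute)

text \<open>Reflection is an involution preserving membership and distances, so each competitor of
  the reflected problem comes from one of the original problem.\<close>

lemma is_best_SI0_approx_reflect:
  assumes "is_best_SI0_approx a b m D f p s"
  shows "is_best_SI0_approx (- b) (- a) m (map uminus (rev D)) (\<lambda>x. - f (- x)) p (\<lambda>x. - s (- x))"
proof -
  have norm: "Lp_norm (- b) (- a) p (\<lambda>x. - f (- x) - h x) = Lp_norm a b p (\<lambda>x. f x - - h (- x))" for h
    using Lp_norm_reflect[of b a p "\<lambda>x. - f x - h (- x)"]
      Lp_norm_minus_commute[of a b p "\<lambda>x. - f x" "\<lambda>x. h (- x)"]
    by (simp add: add.commute)
  have best: "s \<in> SI0 a b m D"
    "\<And>h. h \<in> SI0 a b m D \<Longrightarrow> Lp_norm a b p (\<lambda>x. f x - s x) \<le> Lp_norm a b p (\<lambda>x. f x - h x)"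
    using assms by (simp_all add: is_best_SI0_approx_def)
  have "Lp_norm a b p (\<lambda>x. f x - s x) \<le> Lp_norm a b p (\<lambda>x. f x - - h (- x))"
    if "h \<in> SI0 (- b) (- a) m (map uminus (rev D))" for h
    using SI0_reflect[OF that] by (intro best(2)) (simp add: rev_map o_def)
  then show ?thesis
    unfolding is_best_SI0_approx_def norm using SI0_reflect[OF best(1)] by simp
qed

text \<open>This is the upper bound for \<open>- f (- x)\<close> read backwards; reflection permutes
  the gaps between knots, so the same mesh bound serves.\<close>

lemma best_approx_lower_bound:
  fixes f :: "real \<Rightarrow> real"
  assumes "a < b" and p: "1 \<le> p" and m: "1 \<le> m"
    and contf: "continuous_on {a..b} f" and monof: "mono_on {a..b} f" and "0 < e"
  shows "\<exists>\<delta>>0. \<forall>D s. is_partition a b D \<longrightarrow> (\<forall>i. Suc i < length D \<longrightarrow> D ! Suc i - D ! i \<le> \<delta>) \<longrightarrow>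
    is_best_SI0_approx a b m D f p s \<longrightarrow> (\<forall>x\<in>{a..b}. f x - e \<le> s x)"
proof -
  have "- b < - a" using \<open>a < b\<close> by simp
  from best_approx_upper_bound[OF this p m continuous_on_reflect[OF contf] mono_on_reflect[OF monof] \<open>0 < e\<close>]
  obtain \<delta> where \<delta>: "\<delta> > 0" and upper: "\<And>D s x. is_partition (- b) (- a) D \<Longrightarrow>
      (\<And>i. Suc i < length D \<Longrightarrow> D ! Suc i - D ! i \<le> \<delta>) \<Longrightarrow>
      is_best_SI0_approx (- b) (- a) m D (\<lambda>x. - f (- x)) p s \<Longrightarrow> x \<in> {- b..- a} \<Longrightarrow>
      s x \<le> - f (- x) + e"
    by blast
  show ?thesis
  proof (intro exI[of _ \<delta>] conjI allI impI ballI)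
    fix D s x
    assume part: "is_partition a b D"
      and mesh: "\<forall>i. Suc i < length D \<longrightarrow> D ! Suc i - D ! i \<le> \<delta>"
      and best: "is_best_SI0_approx a b m D f p s"
      and x: "x \<in> {a..b}"
    have "- s (- (- x)) \<le> - f (- (- x)) + e"
    proof (rule upper[OF is_partition_reflect[OF part] _ is_best_SI0_approx_reflect[OF best]])
      fix i assume "Suc i < length (map uminus (rev D))"
      then obtain j where "Suc j < length D" "map uminus (rev D) ! i = - (D ! Suc j)"
        "map uminus (rev D) ! Suc i = - (D ! j)"
        using reflect_cell[of i D] by auto
      with mesh show "map uminus (rev D) ! Suc i - map uminus (rev D) ! i \<le> \<delta>" by force
    qed (use x in auto)
    then show "f x - e \<le> s x" by simp
  qed (rule \<delta>)
qed

section \<open>From small norm to uniform convergence\<close>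

lemma partition_gap_le_norm:
  assumes "Suc i < length D"
  shows "D ! Suc i - D ! i \<le> partition_norm D"
proof -
  have "{D ! Suc i - D ! i | i. Suc i < length D} = (\<lambda>i. D ! Suc i - D ! i) ` {i. Suc i < length D}"
    by auto
  moreover have "finite {i. Suc i < length D}"
    by (rule finite_subset[of _ "{..<length D}"]) auto
  ultimately show ?thesis
    unfolding partition_norm_def using assms by (intro Max_ge) auto
qed

theorem mainTheorem1:
  fixes a b p :: real
    and m :: nat
    and f :: "real \<Rightarrow> real"
    and D :: "nat \<Rightarrow> real list"
    and s :: "nat \<Rightarrow> real \<Rightarrow> real"
  assumes "a < b"
    and "continuous_on {a..b} f"
    and "mono_on {a..b} f"
    and "\<And>n. is_partition a b (D n)"
    and "(\<lambda>n. partition_norm (D n)) \<longlonglongrightarrow> 0"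
    and "1 \<le> p"
    and "1 \<le> m"
    and "\<And>n. is_best_SI0_approx a b m (D n) f p (s n)"
  shows "uniform_limit {a..b} s f sequentially
    \<and> (\<lambda>n. SUP x\<in>{a..b}. \<bar>s n x - f x\<bar>) \<longlonglongrightarrow> 0"
proof
  \<comment> \<open>The bound is not strict; using it with \<open>e / 2\<close> gives the strict
    inequality in both conclusions.\<close>
  have near: "\<forall>\<^sub>F n in sequentially. \<forall>x\<in>{a..b}. \<bar>s n x - f x\<bar> \<le> e" if "0 < e" for e
  proof -
    obtain \<delta>1 where \<delta>1: "\<delta>1 > 0" "\<forall>D s. is_partition a b D \<longrightarrow>
        (\<forall>i. Suc i < length D \<longrightarrow> D ! Suc i - D ! i \<le> \<delta>1) \<longrightarrow>
        is_best_SI0_approx a b m D f p s \<longrightarrow> (\<forall>x\<in>{a..b}. s x \<le> f x + e)"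
      using best_approx_upper_bound[OF assms(1,6,7,2,3) \<open>0 < e\<close>] by blast
    obtain \<delta>2 where \<delta>2: "\<delta>2 > 0" "\<forall>D s. is_partition a b D \<longrightarrow>
        (\<forall>i. Suc i < length D \<longrightarrow> D ! Suc i - D ! i \<le> \<delta>2) \<longrightarrow>
        is_best_SI0_approx a b m D f p s \<longrightarrow> (\<forall>x\<in>{a..b}. f x - e \<le> s x)"
      using best_approx_lower_bound[OF assms(1,6,7,2,3) \<open>0 < e\<close>] by blast
    have "\<forall>\<^sub>F n in sequentially. partition_norm (D n) < min \<delta>1 \<delta>2"
      using order_tendstoD(2)[OF assms(5), of "min \<delta>1 \<delta>2"] \<delta>1(1) \<delta>2(1) by simp
    then show ?thesis
    proof eventually_elim
      case (elim n)
      have "D n ! Suc i - D n ! i \<le> min \<delta>1 \<delta>2" if "Suc i < length (D n)" for i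
        using partition_gap_le_norm[OF that] elim by simp
      then have "\<forall>i. Suc i < length (D n) \<longrightarrow> D n ! Suc i - D n ! i \<le> \<delta>1"
        "\<forall>i. Suc i < length (D n) \<longrightarrow> D n ! Suc i - D n ! i \<le> \<delta>2" by simp_all
      then have "\<forall>x\<in>{a..b}. s n x \<le> f x + e" "\<forall>x\<in>{a..b}. f x - e \<le> s n x"
        using \<delta>1(2) \<delta>2(2) assms(4,8) by blast+
      then show ?case by (force simp: abs_le_iff)
    qed
  qed
  show "uniform_limit {a..b} s f sequentially"
  proof (rule uniform_limitI)
    fix e :: real assume "0 < e"
    show "\<forall>\<^sub>F n in sequentially. \<forall>x\<in>{a..b}. dist (s n x) (f x) < e"
      using near[OF half_gt_zero[OF \<open>0 < e\<close>]] \<open>0 < e\<close>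
      by (auto simp: dist_real_def elim!: eventually_mono intro: order.strict_trans1)
  qed
  show "(\<lambda>n. SUP x\<in>{a..b}. \<bar>s n x - f x\<bar>) \<longlonglongrightarrow> 0"
  proof (rule tendstoI)
    fix e :: real assume "0 < e"
    show "\<forall>\<^sub>F n in sequentially. dist (SUP x\<in>{a..b}. \<bar>s n x - f x\<bar>) 0 < e"
      using near[OF half_gt_zero[OF \<open>0 < e\<close>]]
    proof eventually_elim
      case (elim n)
      then have "(SUP x\<in>{a..b}. \<bar>s n x - f x\<bar>) \<le> e / 2"
        using assms(1) by (intro cSUP_least) auto
      \<comment> \<open>The value at \<open>a\<close> shows that the supremum is nonnegative, so its
        distance from 0 is the supremum itself.\<close>
      moreover have "\<bar>s n a - f a\<bar> \<le> (SUP x\<in>{a..b}. \<bar>s n x - f x\<bar>)"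
        using assms(1) elim by (intro cSUP_upper) (auto intro!: bdd_aboveI2[of _ _ "e / 2"])
      ultimately show ?case using \<open>0 < e\<close> by (simp add: dist_real_def)
    qed
  qed
qed

end
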